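(* Let $q$ be a prime power. The diameter of the bipartite graph $G(2,q)$ is $6$.
   Context: $\mathbb{S}_2(\mathbb{F}_q)$ denotes the set of $2\times 2$ symmetric matrices over $\mathbb{F}_q$ (its elements are called points). Two points $S,S'$ are adjacent if $\operatorname{rank}(S-S')=1$. A line is a maximal set of rank $1$: a subset $\mathcal{M}\subseteq\mathbb{S}_2(\mathbb{F}_q)$ such that any two distinct points of $\mathcal{M}$ are adjacent and no point of $\mathbb{S}_2(\mathbb{F}_q)\setminus\mathcal{M}$ is adjacent to every point of $\mathcal{M}$. $G(2,q)$ is the bipartite graph whose vertex set is the disjoint union of the set of points and the set of lines, with a point joined to a line if and only if the point belongs to the line. The diameter is the maximum over pairs of vertices of the length of a shortest path between them. *)

theory Defs
  imports
    "HOL-Analysis.Analysis"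
    "HOL-Number_Theory.Prime_Powers"
    "Graph_Theory.Pair_Digraph"
    "Graph_Theory.Shortest_Path"
begin

(* With unit weights, \<mu> u v is the length of a shortest path from u to v
   (\<infinity> if there is none), so a disconnected graph has diameter \<infinity>. *)
definition (in fin_digraph) diameter :: ereal where
  "diameter = Max ((\<lambda>(u, v). \<mu> (\<lambda>_. 1) u v) ` (verts G \<times> verts G))"

definition points :: "('a :: field ^ 2 ^ 2) set" where
  "points = {S. transpose S = S}"

definition adjacent :: "'a :: field ^ 2 ^ 2 \<Rightarrow> 'a ^ 2 ^ 2 \<Rightarrow> bool" where
  "adjacent S S' \<longleftrightarrow> rank (S - S') = 1"

definition lines :: "('a :: field ^ 2 ^ 2) set set" where
  "lines = {M. M \<subseteq> points
              \<and> (\<forall>S\<in>M. \<forall>S'\<in>M. S \<noteq> S' \<longrightarrow> adjacent S S')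
              \<and> \<not> (\<exists>P\<in>points - M. \<forall>S\<in>M. adjacent P S)}"

(* An undirected edge is represented by the two opposite arcs. *)
definition G2 :: "'a :: field itself \<Rightarrow> ('a ^ 2 ^ 2 + ('a ^ 2 ^ 2) set) pair_pre_digraph" where
  "G2 _ = \<lparr> pverts = points <+> lines,
            parcs = {(Inl S, Inr M) | S M. S \<in> points \<and> M \<in> lines \<and> S \<in> M}
                  \<union> {(Inr M, Inl S) | S M. S \<in> points \<and> M \<in> lines \<and> S \<in> M} \<rparr>"

(* In particular G2 is a fin_digraph, so that its diameter is meaningful. *)
lemma pair_graph_G2: "pair_graph (G2 TYPE('a :: {field, finite}))"
proof
  show "finite (pverts (G2 TYPE('a)))" "finite (parcs (G2 TYPE('a)))"
    by (rule finite)+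
  show "symmetric (with_proj (G2 TYPE('a)))"
    by (auto simp: G2_def symmetric_def intro!: symI)
qed (auto simp: G2_def)

end

theory Submission
  imports Defs
begin

text \<open>
  In the coordinates \<open>sym2 a b c\<close>, points are adjacent iff their difference is a nonzero
  vector on the cone \<open>a c = b\<^sup>2\<close>, and the lines are the affine lines whose
  direction lies on the cone. Given a point \<open>P\<close> and a line \<open>A + t D\<close>, the condition that
  \<open>P - A - t D\<close> lies on the cone is linear in \<open>t\<close>, because \<open>D\<close> does; it is solvable
  after replacing \<open>P\<close> by a suitable neighbour, so a point and a line are joined by a path of length 5
  and any two vertices by one of length at most 6.
  Conversely, no point of the line \<open>{sym2 t 0 0}\<close> is equal or adjacent to a point of the
  parallel line \<open>{sym2 t 1 0}\<close>, so these two lines are at distance at least 6.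
\<close>

section \<open>Adjacency in coordinates\<close>

text \<open>The rank is at most 2, equals 2 exactly for nonzero determinant and 0 exactly for the
  zero matrix; rank 1 is what remains. This turns adjacency into a polynomial equation.\<close>

lemma rank_2_eq_1_iff:
  fixes A :: "'a :: field ^ 2 ^ 2"
  shows "rank A = 1 \<longleftrightarrow> A \<noteq> 0 \<and> det A = 0"
proof -
  have "det A \<noteq> 0 \<longleftrightarrow> vec.span (rows A) = UNIV"
    using matrix_left_invertible_span_rows_gen[of A] invertible_det_nz[of A]
    by (simp add: invertible_left_inverse)
  also have "\<dots> \<longleftrightarrow> rank A = 2"
  proof
    assume "vec.span (rows A) = UNIV"
    then have "vec.dim (rows A) = vec.dim (UNIV :: ('a ^ 2) set)"
      by (metis vec.dim_span)
    then show "rank A = 2"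
      unfolding row_rank_def_gen vec_dim_card by simp
  next
    assume "rank A = 2"
    then show "vec.span (rows A) = UNIV"
      using vec.dim_eq_full[of "rows A"]
      by (simp add: row_rank_def_gen vec.dimension_def card_cart_basis)
  qed
  finally have full: "det A \<noteq> 0 \<longleftrightarrow> rank A = 2" .
  have "rank A = 0 \<longleftrightarrow> rows A \<subseteq> {0}"
    by (simp add: row_rank_def_gen)
  also have "\<dots> \<longleftrightarrow> A = 0"
    by (simp add: rows_def row_def subset_iff vec_eq_iff) metis
  finally have zero: "rank A = 0 \<longleftrightarrow> A = 0" .
  have "rank A \<le> 2"
    using vec.dim_subset_UNIV[of "rows A"]
    by (simp add: row_rank_def_gen vec.dimension_def card_cart_basis)
  with full zero show ?thesis by auto
qed

definition sym2 :: "'a :: field \<Rightarrow> 'a \<Rightarrow> 'a \<Rightarrow> 'a ^ 2 ^ 2" where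
  "sym2 a b c = vector [vector [a, b], vector [b, c]]"

lemma sym2_eq_iff [simp]: "sym2 a b c = sym2 x y z \<longleftrightarrow> a = x \<and> b = y \<and> c = z"
  by (auto simp: sym2_def vec_eq_iff forall_2)

lemma sym2_in_points [simp]: "sym2 a b c \<in> points"
  by (simp add: points_def sym2_def vec_eq_iff forall_2 transpose_def)

lemma points_cases:
  assumes "S \<in> points"
  obtains a b c where "S = sym2 a b c"
proof
  have "transpose S $ 2 $ 1 = S $ 1 $ 2" by (simp add: transpose_def)
  with assms have "S $ 2 $ 1 = S $ 1 $ 2" by (simp add: points_def)
  then show "S = sym2 (S $ 1 $ 1) (S $ 1 $ 2) (S $ 2 $ 2)"
    by (simp add: sym2_def vec_eq_iff forall_2)
qed

lemma adjacent_sym2_iff: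
  "adjacent (sym2 a b c) (sym2 x y z) \<longleftrightarrow>
     sym2 a b c \<noteq> sym2 x y z \<and> (a - x) * (c - z) = (b - y)\<^sup>2"
  unfolding adjacent_def rank_2_eq_1_iff
  by (simp add: det_2 sym2_def power2_eq_square)

section \<open>Lines as affine lines with direction on the cone\<close>

text \<open>A subspace on which the quadratic form \<open>a * c - b\<^sup>2\<close> vanishes has
  dimension at most 1. The argument never divides by 2, so it covers characteristic 2.\<close>

lemma cone_collinear:
  fixes a b c x y z :: "'a :: field"
  assumes "(a, b, c) \<noteq> (0, 0, 0)" "a * c = b\<^sup>2" "x * z = y\<^sup>2"
    and "(x - a) * (z - c) = (y - b)\<^sup>2"
  obtains t where "x = t * a" "y = t * b" "z = t * c"
proof -
  \<comment> \<open>This is the polar form of the two vectors. It vanishes because the form vanishes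
    on both of them and on their difference.\<close>
  have "x * c + a * z - 2 * y * b
      = ((y - b)\<^sup>2 - (x - a) * (z - c)) + (x * z - y\<^sup>2) + (a * c - b\<^sup>2)"
    by (simp add: algebra_simps power2_eq_square)
  then have lin: "x * c + a * z = 2 * y * b"
    using assms(2-4) by simp
  have "(x * b - a * y)\<^sup>2 = x\<^sup>2 * b\<^sup>2 + a\<^sup>2 * y\<^sup>2 - a * x * (2 * y * b)"
    by (simp add: algebra_simps power2_eq_square)
  also have "\<dots> = x\<^sup>2 * (a * c) + a\<^sup>2 * (x * z) - a * x * (x * c + a * z)"
    by (simp only: assms(2,3) lin)
  also have "\<dots> = 0"
    by (simp add: algebra_simps power2_eq_square)
  finally have xb: "x * b = a * y" by simp
  show thesis
  proof (cases "a = 0")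
    case False
    have "a * (x * c + a * z) = 2 * b * (x * b)"
      unfolding lin xb by (simp add: algebra_simps)
    also have "\<dots> = 2 * x * (a * c)"
      unfolding assms(2) by (simp add: power2_eq_square)
    finally have "a * (a * z) = a * (x * c)"
      by (simp add: algebra_simps)
    then have "a * z = x * c" using False by simp
    then show thesis
      using False xb by (intro that[of "x / a"]) (auto simp: field_simps)
  next
    case True
    then have "b = 0" "c \<noteq> 0" using assms(1,2) by auto
    then have "x = 0" using True lin by simp
    then have "y = 0" using assms(3) by simp
    then show thesis
      using True \<open>b = 0\<close> \<open>c \<noteq> 0\<close> \<open>x = 0\<close> by (intro that[of "z / c"]) auto
  qed
qed

definition cone_line :: "'a :: field \<Rightarrow> 'a \<Rightarrow> 'a \<Rightarrow> 'a \<Rightarrow> 'a \<Rightarrow> 'a \<Rightarrow> ('a ^ 2 ^ 2) set" where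
  "cone_line x y z a b c = range (\<lambda>t. sym2 (x + t * a) (y + t * b) (z + t * c))"

lemma cone_line_adjacent:
  assumes "a * c = b\<^sup>2" "S \<in> cone_line x y z a b c" "S' \<in> cone_line x y z a b c" "S \<noteq> S'"
  shows "adjacent S S'"
proof -
  obtain s t where "S = sym2 (x + s * a) (y + s * b) (z + s * c)"
    and "S' = sym2 (x + t * a) (y + t * b) (z + t * c)"
    using assms(2,3) by (auto simp: cone_line_def)
  moreover have "(x + s * a - (x + t * a)) * (z + s * c - (z + t * c)) = (s - t)\<^sup>2 * (a * c)"
    "(y + s * b - (y + t * b))\<^sup>2 = (s - t)\<^sup>2 * b\<^sup>2"
    by (simp_all add: algebra_simps power2_eq_square)
  ultimately show ?thesis
    using assms(1,4) by (simp add: adjacent_sym2_iff)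
qed

text \<open>Two points of the line suffice to test membership: \<open>cone_collinear\<close> applies
  to \<open>P\<close> minus the base point. Equality is allowed because it satisfies the same
  equation as adjacency.\<close>

lemma in_cone_lineI:
  assumes "(a, b, c) \<noteq> (0, 0, 0)" "a * c = b\<^sup>2" "P \<in> points"
    and "P = sym2 x y z \<or> adjacent P (sym2 x y z)"
    and "P = sym2 (x + a) (y + b) (z + c) \<or> adjacent P (sym2 (x + a) (y + b) (z + c))"
  shows "P \<in> cone_line x y z a b c"
proof -
  obtain u v w where P: "P = sym2 u v w" using assms(3) by (rule points_cases)
  have "(u - x) * (w - z) = (v - y)\<^sup>2" "(u - x - a) * (w - z - c) = (v - y - b)\<^sup>2"
    using assms(4,5) unfolding P by (auto simp: adjacent_sym2_iff algebra_simps)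
  then obtain t where "u - x = t * a" "v - y = t * b" "w - z = t * c"
    using assms(1,2) by (metis cone_collinear)
  then have "P = sym2 (x + t * a) (y + t * b) (z + t * c)"
    by (simp add: P algebra_simps)
  then show ?thesis by (auto simp: cone_line_def)
qed

lemma base_in_cone_line:
  "sym2 x y z \<in> cone_line x y z a b c" "sym2 (x + a) (y + b) (z + c) \<in> cone_line x y z a b c"
  by (auto simp: cone_line_def intro: range_eqI[of _ _ 0] range_eqI[of _ _ 1])

lemma cone_line_in_lines:
  assumes "(a, b, c) \<noteq> (0, 0, 0)" "a * c = b\<^sup>2"
  shows "cone_line x y z a b c \<in> lines"
proof -
  have "cone_line x y z a b c \<subseteq> points" by (auto simp: cone_line_def)
  moreover have "P \<in> cone_line x y z a b c"
    if "P \<in> points" "\<forall>S \<in> cone_line x y z a b c. adjacent P S" for P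
    using that assms base_in_cone_line by (intro in_cone_lineI) blast+
  ultimately show ?thesis
    using cone_line_adjacent[OF assms(2)] unfolding lines_def by blast
qed

lemma lines_subset_points: "M \<in> lines \<Longrightarrow> M \<subseteq> points"
  by (simp add: lines_def)

lemma lines_adjacent: "M \<in> lines \<Longrightarrow> S \<in> M \<Longrightarrow> S' \<in> M \<Longrightarrow> S \<noteq> S' \<Longrightarrow> adjacent S S'"
  by (auto simp: lines_def)

lemma lines_maximal:
  assumes "M \<in> lines" "P \<in> points" "\<And>S. S \<in> M \<Longrightarrow> S \<noteq> P \<Longrightarrow> adjacent P S"
  shows "P \<in> M"
  using assms unfolding lines_def by blast

text \<open>Two distinct points of \<open>M\<close> span a cone line, which contains
  \<open>M\<close> by \<open>in_cone_lineI\<close>; maximality of \<open>M\<close> then gives the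
  reverse inclusion.\<close>

lemma line_contains_cone_line:
  assumes M: "M \<in> lines"
  obtains x y z a b c where "(a, b, c) \<noteq> (0, 0, 0)" "a * c = b\<^sup>2" "cone_line x y z a b c \<subseteq> M"
proof -
  \<comment> \<open>The empty set is not maximal: every point is vacuously adjacent to all its
    elements.\<close>
  obtain P where P: "P \<in> M"
    using lines_maximal[OF M sym2_in_points] by blast
  then obtain x y z where xyz: "P = sym2 x y z"
    using lines_subset_points[OF M] points_cases by blast
  have "M \<noteq> {P}"
  proof
    assume M_eq: "M = {P}"
    have "sym2 (x + 1) y z \<in> M"
      using M by (rule lines_maximal) (simp_all add: M_eq xyz adjacent_sym2_iff)
    then show False by (simp add: M_eq xyz)
  qed
  with P obtain Q where Q: "Q \<in> M" "Q \<noteq> P" by blast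
  then obtain u v w where uvw: "Q = sym2 u v w"
    using lines_subset_points[OF M] points_cases by blast
  define a b c where "a = u - x" and "b = v - y" and "c = w - z"
  have Q_eq: "Q = sym2 (x + a) (y + b) (z + c)"
    by (simp add: uvw a_def b_def c_def)
  have abc: "(a, b, c) \<noteq> (0, 0, 0)" "a * c = b\<^sup>2"
    using lines_adjacent[OF M Q(1) P Q(2)] Q(2)
    by (auto simp: xyz uvw adjacent_sym2_iff a_def b_def c_def)
  have M_sub: "M \<subseteq> cone_line x y z a b c"
  proof
    fix S assume S: "S \<in> M"
    then show "S \<in> cone_line x y z a b c"
      using abc lines_subset_points[OF M] lines_adjacent[OF M S P] lines_adjacent[OF M S Q(1)]
      by (intro in_cone_lineI) (auto simp: xyz Q_eq)
  qed
  have "R \<in> M" if R: "R \<in> cone_line x y z a b c" for R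
  proof (rule lines_maximal[OF M])
    show "R \<in> points" using R by (auto simp: cone_line_def)
    show "adjacent R S" if "S \<in> M" "S \<noteq> R" for S
      using that M_sub R cone_line_adjacent[OF abc(2)] by blast
  qed
  with abc that show thesis by blast
qed

section \<open>Reaching a line from a point\<close>

text \<open>This is the existence of a walk of length 2 between two points; \<open>P = Q\<close> is
  allowed.\<close>

definition collinear2 :: "'a :: field ^ 2 ^ 2 \<Rightarrow> 'a ^ 2 ^ 2 \<Rightarrow> bool" where
  "collinear2 P Q \<longleftrightarrow> (\<exists>M \<in> lines. P \<in> M \<and> Q \<in> M)"

lemma collinear2I:
  assumes "(a - x) * (c - z) = (b - y)\<^sup>2"
  shows "collinear2 (sym2 a b c) (sym2 x y z)"
proof (cases "sym2 a b c = sym2 x y z")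
  case True
  have "cone_line x y z 1 0 0 \<in> lines"
    by (rule cone_line_in_lines) auto
  then show ?thesis
    unfolding collinear2_def True
    using base_in_cone_line(1)[of x y z 1 0 0] by (intro bexI[of _ "cone_line x y z 1 0 0"] conjI)
next
  case False
  have "cone_line x y z (a - x) (b - y) (c - z) \<in> lines"
    using assms False by (intro cone_line_in_lines) auto
  moreover have "sym2 a b c \<in> cone_line x y z (a - x) (b - y) (c - z)"
    using base_in_cone_line(2)[of x "a - x" y "b - y" z "c - z"] by simp
  moreover have "sym2 x y z \<in> cone_line x y z (a - x) (b - y) (c - z)"
    by (rule base_in_cone_line(1))
  ultimately show ?thesis
    unfolding collinear2_def by (intro bexI conjI)
qed

text \<open>The last assumption says that the polar form of the direction and \<open>P\<close> minus
  the base point is nonzero, where \<open>P\<close> is \<open>sym2 u v w\<close>. It is the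
  coefficient of \<open>t\<close> in the cone equation, whose \<open>t\<^sup>2\<close> term
  vanishes.\<close>

lemma collinear2_line:
  assumes "(a, b, c) \<noteq> (0, 0, 0)" "a * c = b\<^sup>2" "cone_line x y z a b c \<subseteq> M"
    and "(u - x) * c + a * (w - z) \<noteq> 2 * (v - y) * b"
  obtains S where "S \<in> M" "collinear2 (sym2 u v w) S"
proof -
  define k where "k = (u - x) * c + a * (w - z) - 2 * (v - y) * b"
  \<comment> \<open>The root of that linear equation.\<close>
  define t where "t = ((u - x) * (w - z) - (v - y)\<^sup>2) / k"
  have "t * k = (u - x) * (w - z) - (v - y)\<^sup>2"
    using assms(4) by (simp add: t_def k_def)
  moreover have "(u - (x + t * a)) * (w - (z + t * c)) - (v - (y + t * b))\<^sup>2
      = (u - x) * (w - z) - (v - y)\<^sup>2 - t * k + t\<^sup>2 * (a * c - b\<^sup>2)"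
    by (simp add: k_def algebra_simps power2_eq_square)
  ultimately have "(u - (x + t * a)) * (w - (z + t * c)) = (v - (y + t * b))\<^sup>2"
    using assms(2) by simp
  then show thesis
    using assms(3) by (intro that[of "sym2 (x + t * a) (y + t * b) (z + t * c)"] collinear2I)
      (auto simp: cone_line_def)
qed

text \<open>If the coefficient vanishes at \<open>P\<close>, a step from \<open>P\<close> along
  \<open>(1, 0, 0)\<close> or \<open>(0, 0, 1)\<close> changes it by \<open>c\<close> or
  \<open>a\<close>. These are not both 0, since the cone equation would then force
  \<open>b = 0\<close>.\<close>

lemma point_line_path:
  assumes "P \<in> points" "M \<in> lines"
  obtains Q S where "collinear2 P Q" "collinear2 Q S" "S \<in> M"
proof -
  obtain x y z a b c where D: "(a, b, c) \<noteq> (0, 0, 0)" "a * c = b\<^sup>2"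
    and sub: "cone_line x y z a b c \<subseteq> M"
    using assms(2) by (rule line_contains_cone_line)
  obtain u v w where P: "P = sym2 u v w" using assms(1) by (rule points_cases)
  define k where "k = (\<lambda>u w. (u - x) * c + a * (w - z) - 2 * (v - y) * b)"
  have "k (u + 1) w - k u w = c" "k u (w + 1) - k u w = a"
    by (simp_all add: k_def algebra_simps)
  moreover have "a \<noteq> 0 \<or> c \<noteq> 0" using D by auto
  ultimately have "k u w \<noteq> 0 \<or> k (u + 1) w \<noteq> 0 \<or> k u (w + 1) \<noteq> 0" by auto
  then obtain u' w' where k: "k u' w' \<noteq> 0" and u'w': "u' = u \<or> w' = w"
    by blast
  obtain S where "S \<in> M" "collinear2 (sym2 u' v w') S"
    using collinear2_line[OF D sub, of u' w' v] k by (auto simp: k_def)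
  moreover have "collinear2 P (sym2 u' v w')"
    unfolding P using u'w' by (intro collinear2I) auto
  ultimately show thesis using that by blast
qed

section \<open>Walks in the incidence graph\<close>

interpretation G2: pair_graph "G2 TYPE('a :: {field, finite})"
  by (rule pair_graph_G2)

abbreviation awalk_G2 ::
  "'a :: {field, finite} ^ 2 ^ 2 + ('a ^ 2 ^ 2) set \<Rightarrow>
   (('a ^ 2 ^ 2 + ('a ^ 2 ^ 2) set) \<times> ('a ^ 2 ^ 2 + ('a ^ 2 ^ 2) set)) list \<Rightarrow>
   'a ^ 2 ^ 2 + ('a ^ 2 ^ 2) set \<Rightarrow> bool" where
  "awalk_G2 \<equiv> pre_digraph.awalk (with_proj (G2 TYPE('a)))"

lemma verts_G2: "Inl S \<in> pverts (G2 TYPE('a :: field)) \<longleftrightarrow> S \<in> points"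
    "Inr M \<in> pverts (G2 TYPE('a)) \<longleftrightarrow> M \<in> lines"
  by (auto simp: G2_def)

lemma arcs_G2: "(u, v) \<in> parcs (G2 TYPE('a :: field)) \<longleftrightarrow>
    (\<exists>S M. M \<in> lines \<and> S \<in> M \<and> (u = Inl S \<and> v = Inr M \<or> u = Inr M \<and> v = Inl S))"
  by (auto simp: G2_def dest: subsetD[OF lines_subset_points])

lemma awalk_G2_Nil: "awalk_G2 u [] v \<longleftrightarrow> u = v \<and> u \<in> pverts (G2 TYPE('a :: {field, finite}))"
  by (simp add: G2.awalk_Nil_iff)

lemma awalk_G2_Cons:
  "awalk_G2 u (e # p) v \<longleftrightarrow>
     e \<in> parcs (G2 TYPE('a :: {field, finite})) \<and> fst e = u \<and> awalk_G2 (snd e) p v"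
  by (auto simp: G2.awalk_Cons_iff)

text \<open>Each \<open>collinear2\<close> gives two arcs and \<open>S \<in> M\<close> the fifth.
  Walks may repeat vertices, so coinciding points or lines need no separate treatment.\<close>

lemma walk_point_line:
  assumes "P \<in> points" "M \<in> lines"
  shows "\<exists>p. awalk_G2 (Inl P) p (Inr M) \<and> length p = 5"
    and "\<exists>p. awalk_G2 (Inr M) p (Inl P) \<and> length p = 5"
proof -
  obtain Q S where "collinear2 P Q" "collinear2 Q S" and S: "S \<in> M"
    using assms by (rule point_line_path)
  then obtain N N' where N: "N \<in> lines" "P \<in> N" "Q \<in> N" and N': "N' \<in> lines" "Q \<in> N'" "S \<in> N'"
    by (auto simp: collinear2_def)
  show "\<exists>p. awalk_G2 (Inl P) p (Inr M) \<and> length p = 5"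
    using N N' S assms
    by (intro exI[of _ "[(Inl P, Inr N), (Inr N, Inl Q), (Inl Q, Inr N'), (Inr N', Inl S),
          (Inl S, Inr M)]"])
      (simp add: awalk_G2_Cons awalk_G2_Nil arcs_G2 verts_G2)
  show "\<exists>p. awalk_G2 (Inr M) p (Inl P) \<and> length p = 5"
    using N N' S assms
    by (intro exI[of _ "[(Inr M, Inl S), (Inl S, Inr N'), (Inr N', Inl Q), (Inl Q, Inr N),
          (Inr N, Inl P)]"])
      (simp add: awalk_G2_Cons awalk_G2_Nil arcs_G2 verts_G2)
qed

text \<open>For two vertices of the same kind, one extra arc to a neighbour of \<open>u\<close>
  reduces to the mixed case.\<close>

lemma walk_le_6:
  assumes "u \<in> pverts (G2 TYPE('a :: {field, finite}))" "v \<in> pverts (G2 TYPE('a))"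
  shows "\<exists>p. awalk_G2 u p v \<and> length p \<le> 6"
proof (cases u)
  case u: (Inl P)
  then have P: "P \<in> points" using assms(1) by (simp add: verts_G2)
  \<comment> \<open>A line through \<open>P\<close> comes from
    \<open>collinear2 P P\<close>.\<close>
  then obtain M where M: "M \<in> lines" "P \<in> M"
    by (metis points_cases collinear2I collinear2_def diff_self mult_zero_left zero_power2)
  show ?thesis
  proof (cases v)
    case v: (Inl Q)
    then have "Q \<in> points" using assms(2) by (simp add: verts_G2)
    then obtain p where "awalk_G2 (Inr M) p v" "length p = 5"
      using walk_point_line(2) M(1) v by blast
    then show ?thesis
      using M u by (intro exI[of _ "(Inl P, Inr M) # p"]) (simp add: awalk_G2_Cons arcs_G2)
  next
    case (Inr N)
    then have "N \<in> lines" using assms(2) by (simp add: verts_G2)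
    with walk_point_line(1)[OF P this] show ?thesis using u Inr by auto
  qed
next
  case u: (Inr M)
  then have M: "M \<in> lines" using assms(1) by (simp add: verts_G2)
  show ?thesis
  proof (cases v)
    case (Inl Q)
    then have "Q \<in> points" using assms(2) by (simp add: verts_G2)
    with walk_point_line(2)[OF this M] show ?thesis using u Inl by auto
  next
    case v: (Inr N)
    then have N: "N \<in> lines" using assms(2) by (simp add: verts_G2)
    obtain S where S: "S \<in> M"
      using lines_maximal[OF M sym2_in_points] by blast
    then obtain p where "awalk_G2 (Inl S) p v" "length p = 5"
      using walk_point_line(1) N lines_subset_points[OF M] v by blast
    then show ?thesis
      using M S u by (intro exI[of _ "(Inr M, Inl S) # p"]) (simp add: awalk_G2_Cons arcs_G2)
  qed
qed

lemma awalk_G2_line_cases: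
  assumes "awalk_G2 (Inr M) p (Inr N)"
  obtains "p = []" "M = N"
  | S M' p' where "length p = length p' + 2" "S \<in> M" "S \<in> M'" "M' \<in> lines"
      "awalk_G2 (Inr M') p' (Inr N)"
proof (cases p)
  case Nil
  with assms show thesis by (intro that(1)) (simp_all add: awalk_G2_Nil)
next
  case p: (Cons e q)
  then obtain S where S: "S \<in> M" "awalk_G2 (Inl S) q (Inr N)"
    using assms by (cases e) (auto simp: awalk_G2_Cons arcs_G2)
  show thesis
  proof (cases q)
    case Nil
    with S show thesis by (simp add: awalk_G2_Nil)
  next
    case q: (Cons e' p')
    then obtain M' where "M' \<in> lines" "S \<in> M'" "awalk_G2 (Inr M') p' (Inr N)"
      using S by (cases e') (auto simp: awalk_G2_Cons arcs_G2)
    then show thesis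
      using S(1) p q by (intro that(2)) simp_all
  qed
qed

text \<open>A shorter walk would be \<open>M\<close>, \<open>S\<close>, \<open>M1\<close>,
  \<open>S'\<close>, \<open>N\<close>, but two points of \<open>M1\<close> are equal or
  adjacent.\<close>

lemma walk_ge_6:
  assumes sep: "\<And>S S'. S \<in> M \<Longrightarrow> S' \<in> N \<Longrightarrow> S \<noteq> S' \<and> \<not> adjacent S S'"
    and "M \<noteq> {}" and walk: "awalk_G2 (Inr M) p (Inr N)"
  shows "length p \<ge> 6"
proof (rule ccontr)
  assume short: "\<not> length p \<ge> 6"
  have disj: "M \<inter> N = {}" using sep by blast
  from walk obtain S M1 p1 where 1: "length p = length p1 + 2" "S \<in> M" "S \<in> M1" "M1 \<in> lines"
    "awalk_G2 (Inr M1) p1 (Inr N)"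
    using disj \<open>M \<noteq> {}\<close> by (cases rule: awalk_G2_line_cases) auto
  \<comment> \<open>The walk cannot stop at \<open>M1\<close>: if \<open>M1 = N\<close>, then
    \<open>S\<close> would lie in both \<open>M\<close> and \<open>N\<close>.\<close>
  from 1(5) obtain S' M2 p2 where 2: "length p1 = length p2 + 2" "S' \<in> M1" "S' \<in> M2"
    "awalk_G2 (Inr M2) p2 (Inr N)"
    using disj 1(2,3) by (cases rule: awalk_G2_line_cases) auto
  from 2(4) have "M2 = N"
    using short 1(1) 2(1) by (cases rule: awalk_G2_line_cases) auto
  then have "S \<noteq> S' \<and> \<not> adjacent S S'" using sep 1(2) 2(3) by blast
  with lines_adjacent[OF 1(4,3) 2(2)] show False by blast
qed

theorem theorem2:
  fixes q :: nat
  assumes "primepow q"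
    and "CARD('a :: {field, finite}) = q"
  shows "fin_digraph.diameter (with_proj (G2 TYPE('a))) = 6"
proof -
  let ?V = "pverts (G2 TYPE('a))"
  let ?d = "\<lambda>u v. wf_digraph.\<mu> (with_proj (G2 TYPE('a))) (\<lambda>_. 1) u v"
  have cost: "wf_digraph.awalk_cost (\<lambda>_. 1) p = real (length p)"
    for p :: "(('a ^ 2 ^ 2 + ('a ^ 2 ^ 2) set) \<times> ('a ^ 2 ^ 2 + ('a ^ 2 ^ 2) set)) list"
    by (induction p) simp_all
  have le: "?d u v \<le> 6" if uv: "u \<in> ?V" "v \<in> ?V" for u v
  proof -
    obtain p where p: "awalk_G2 u p v" "length p \<le> 6" using walk_le_6[OF uv] by blast
    have "?d u v \<le> ereal (real (length p))"
      using G2.min_cost_le_walk_cost[OF p(1), of "\<lambda>_. 1"] by (simp add: cost)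
    also have "\<dots> \<le> 6" using p(2) by simp
    finally show ?thesis .
  qed
  define M N :: "('a ^ 2 ^ 2) set" where "M = cone_line 0 0 0 1 0 0" and "N = cone_line 0 1 0 1 0 0"
  have MN: "M \<in> lines" "N \<in> lines"
    unfolding M_def N_def by (rule cone_line_in_lines; simp)+
  \<comment> \<open>The off-diagonal entries differ by 1 and the last entries agree, so the cone
    equation would read \<open>0 = 1\<close>.\<close>
  have "S \<noteq> S' \<and> \<not> adjacent S S'" if "S \<in> M" "S' \<in> N" for S S'
    using that by (auto simp: M_def N_def cone_line_def adjacent_sym2_iff)
  moreover have "M \<noteq> {}" by (simp add: M_def cone_line_def)
  ultimately have "6 \<le> length p" if "awalk_G2 (Inr M) p (Inr N)" for p
    using walk_ge_6 that by blast
  then have "6 \<le> ?d (Inr M) (Inr N)"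
    unfolding G2.\<mu>_def by (intro INF_greatest) (simp add: cost)
  with le MN have eq: "?d (Inr M) (Inr N) = 6"
    by (intro antisym) (auto simp: verts_G2)
  have "6 \<in> (\<lambda>(u, v). ?d u v) ` (?V \<times> ?V)"
    using eq MN by (intro image_eqI[of _ _ "(Inr M, Inr N)"]) (auto simp: verts_G2)
  then have "Max ((\<lambda>(u, v). ?d u v) ` (?V \<times> ?V)) = 6"
    using le by (intro Max_eqI) auto
  then show ?thesis
    by (simp add: G2.diameter_def)
qed

end
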